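(* There is a system of functions $\{\pi_F\}_{F\in\mathfrak{F}}$ such that for any $F,G\in\mathfrak{F}$: - $\pi_F:\mathbb{R}^\omega\to{}^*\mathcal{R}(F)$; - if $f:G\supseteq F$ is an arrow of $\mathfrak{F}$, then ${}^*\mathcal{R}(f)\circ\pi_F=\pi_G$; - for any $\mathscr{L}$-formula $\phi(\overline{x})$ and any tuple $\overline{a}$ of elements of $\mathbb{R}^\omega$, ${}^*\mathcal{R}(F)\Vdash\phi(\pi_F(\overline{a}))$ (in sheaf semantics) iff $F\Vdash\phi(\overline{a})$ in the possibility structure ${}^\dagger\mathcal{R}$.
   Context: Background theory: ZF + Dependent Choices. Fréchet category: $\mathfrak{F}$ is the poset category whose objects are all proper filters on $\omega$ extending the filter of cofinite subsets, with a unique arrow $G\to F$ iff $F\subseteq G$; such an arrow is written $f:G\supseteq F$. A collection $\{H_i\}_{i\in I}$ of elements of $\mathfrak{F}$ covers $F\in\mathfrak{F}$ if (i) $H_i\supseteq F$ for all $i\in I$; (ii) for any $i\in I$ and $H\in\mathfrak{F}$ with $H\supseteq H_i$, $H=H_j$ for some $j\in I$; (iii) for any $G\in\mathfrak{F}$ with $G\supseteq F$ there is $i\in I$ with $H_i\supseteq G$. $\mathscr{L}$ is the first-order language (with equality) with a relation symbol for every finitary relation on $\mathbb{R}$ and a function symbol for every finitary function on $\mathbb{R}$; $\mathcal{R}$ is the $\mathscr{L}$-structure with domain $\mathbb{R}$ with the obvious interpretation. For a tuple $\overline{a}$ from $\mathbb{R}^\omega$, $\overline{a}(i)$ is the tuple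 of $i$-th values. The possibility structure ${}^\dagger\mathcal{R}$ has viewpoints $\mathfrak{F}$ and domain $\mathbb{R}^\omega$, function symbols interpreted pointwise, and forcing relation ($F\in\mathfrak{F}$; $G,H$ range over $\mathfrak{F}$): - $\phi$ atomic (including equations, terms evaluated pointwise): $F\Vdash\phi(\overline{a})$ iff $\{i\in\omega:\mathcal{R}\models\phi(\overline{a}(i))\}\in F$; - $F\Vdash\neg\psi$ iff for all $G\supseteq F$, $G\nVdash\psi$; - $F\Vdash\psi\wedge\chi$ iff $F\Vdash\psi$ and $F\Vdash\chi$; - $F\Vdash\psi\vee\chi$ iff for all $G\supseteq F$ there is $H\supseteq G$ with $H\Vdash\psi$ or $H\Vdash\chi$; - $F\Vdash\psi\to\chi$ iff for all $G\supseteq F$, $G\Vdash\psi$ implies $G\Vdash\chi$; - $F\Vdash\forall x\psi$ iff $F\Vdash\psi(b)$ for all $b\in\mathbb{R}^\omega$; - $F\Vdash\exists x\psi$ iff for all $G\supseteq F$ there are $H\supseteq G$ and $b\in\mathbb{R}^\omega$ with $H\Vdash\psi(b)$. The presheaf ${}^*\mathcal{R}:\mathfrak{F}\to\mathbf{Sets}$ (contravariant): ${}^*\mathcal{R}(F)$ is the reduced power of $\mathbb{R}$ modulo $F$, i.e. the set of classes $a_F$ of functions $a:\omega\to\mathbb{R}$ under $a\sim_F a'$ iff $\{i:a(i)=a'(i)\}\in F$, with function symbols interpreted pointwise on representatives; for $f:G\supseteq F$, ${}^*\mathcal{R}(f)(a_F)=a_G$. Its sheaf-semantics forcing relation (written $\alpha={}^*\mathcal{R}$,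 $\overline{u}$ a tuple from $\alpha(F)$, maps applied componentwise) is: - $\phi$ atomic: $\alpha(F)\Vdash\phi(\overline{a_F})$ iff $\{i\in\omega:\mathcal{R}\models\phi(\overline{a}(i))\}\in F$; - $\alpha(F)\Vdash\neg\psi(\overline{u})$ iff for all $f:G\supseteq F$, $\alpha(G)\nVdash\psi(\alpha(f)(\overline{u}))$; - $\alpha(F)\Vdash(\psi\wedge\chi)(\overline{u})$ iff $\alpha(F)\Vdash\psi(\overline{u})$ and $\alpha(F)\Vdash\chi(\overline{u})$; - $\alpha(F)\Vdash(\psi\vee\chi)(\overline{u})$ iff there is a cover $\{f_i:H_i\supseteq F\}_{i\in I}$ of $F$ such that for every $i\in I$, $\alpha(H_i)\Vdash\psi(\alpha(f_i)(\overline{u}))$ or $\alpha(H_i)\Vdash\chi(\alpha(f_i)(\overline{u}))$; - $\alpha(F)\Vdash(\psi\to\chi)(\overline{u})$ iff for all $f:G\supseteq F$, $\alpha(G)\Vdash\psi(\alpha(f)(\overline{u}))$ implies $\alpha(G)\Vdash\chi(\alpha(f)(\overline{u}))$; - $\alpha(F)\Vdash\forall x\psi(\overline{u},x)$ iff for all $f:G\supseteq F$, $\alpha(G)\Vdash\psi(\alpha(f)(\overline{u}),b)$ for every $b\in\alpha(G)$; - $\alpha(F)\Vdash\exists x\psi(\overline{u},x)$ iff there is a cover $\{f_i:H_i\supseteq F\}_{i\in I}$ of $F$ such that for every $i\in I$, $\alpha(H_i)\Vdash\psi(\alpha(f_i)(\overline{u}),b)$ for some $b\in\alpha(H_i)$.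 *)

theory Defs
  imports Complex_Main "HOL-Library.FuncSet"
begin

text \<open>
  A function symbol is a pair (n, f) where f is a function on lists that is extensional
  outside the lists of length n; a relation symbol is a pair (n, R) where R is a set of lists
  of length n. With these side conditions, imposed by the well-formedness predicates,
  symbols correspond exactly to n-ary functions and relations on the reals.
\<close>

datatype tm = Var nat | Fn nat "real list \<Rightarrow> real" "tm list"

datatype atom = Eq tm tm | Rel nat "real list set" "tm list"

datatype fm =
    Atom atom
  | Neg fm
  | Conj fm fm
  | Disj fm fm
  | Impl fm fm
  | All nat fm
  | Ex nat fm

fun wf_tm :: "tm \<Rightarrow> bool" where
  "wf_tm (Var x) \<longleftrightarrow> True"
| "wf_tm (Fn n f ts) \<longleftrightarrow>
     f \<in> {xs. length xs = n} \<rightarrow>\<^sub>E UNIV \<and> length ts = n \<and> (\<forall>t\<in>set ts. wf_tm t)"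

fun wf_atom :: "atom \<Rightarrow> bool" where
  "wf_atom (Eq s t) \<longleftrightarrow> wf_tm s \<and> wf_tm t"
| "wf_atom (Rel n R ts) \<longleftrightarrow>
     R \<subseteq> {xs. length xs = n} \<and> length ts = n \<and> (\<forall>t\<in>set ts. wf_tm t)"

fun wf_fm :: "fm \<Rightarrow> bool" where
  "wf_fm (Atom A) \<longleftrightarrow> wf_atom A"
| "wf_fm (Neg p) \<longleftrightarrow> wf_fm p"
| "wf_fm (Conj p q) \<longleftrightarrow> wf_fm p \<and> wf_fm q"
| "wf_fm (Disj p q) \<longleftrightarrow> wf_fm p \<and> wf_fm q"
| "wf_fm (Impl p q) \<longleftrightarrow> wf_fm p \<and> wf_fm q"
| "wf_fm (All x p) \<longleftrightarrow> wf_fm p"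
| "wf_fm (Ex x p) \<longleftrightarrow> wf_fm p"

primrec tm_val :: "(nat \<Rightarrow> real) \<Rightarrow> tm \<Rightarrow> real" where
  "tm_val e (Var x) = e x"
| "tm_val e (Fn n f ts) = f (map (tm_val e) ts)"

primrec atom_holds :: "(nat \<Rightarrow> real) \<Rightarrow> atom \<Rightarrow> bool" where
  "atom_holds e (Eq s t) \<longleftrightarrow> tm_val e s = tm_val e t"
| "atom_holds e (Rel n R ts) \<longleftrightarrow> map (tm_val e) ts \<in> R"

text \<open>
  The library orders filters by refinement: G contains F as a family of sets iff
  \<open>G \<le> F\<close>, and the improper filter is \<open>bot\<close>. A set A belongs to F iff
  \<open>eventually (\<lambda>i. i \<in> A) F\<close>.
\<close>

definition frechet :: "nat filter set" where
  "frechet = {F. F \<noteq> bot \<and> F \<le> cofinite}"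

lemma filter_le_iff_contains:
  "G \<le> F \<longleftrightarrow> {A. eventually (\<lambda>i. i \<in> A) F} \<subseteq> {A. eventually (\<lambda>i. i \<in> A) G}"
proof
  assume r: "{A. eventually (\<lambda>i. i \<in> A) F} \<subseteq> {A. eventually (\<lambda>i. i \<in> A) G}"
  show "G \<le> F"
  proof (rule filter_leI)
    fix P assume "eventually P F"
    then have "eventually (\<lambda>i. i \<in> Collect P) F" by simp
    then have "Collect P \<in> {A. eventually (\<lambda>i. i \<in> A) G}" using r by blast
    then show "eventually P G" by simp
  qed
qed (auto dest: filter_leD)

lemma mem_frechet_iff:
  "F \<in> frechet \<longleftrightarrow>
     \<not> eventually (\<lambda>i. i \<in> {}) F \<and> (\<forall>A. finite (- A) \<longrightarrow> eventually (\<lambda>i. i \<in> A) F)"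
proof -
  have "F \<le> cofinite \<longleftrightarrow> (\<forall>A. finite (- A) \<longrightarrow> eventually (\<lambda>i. i \<in> A) F)"
    by (auto simp: filter_le_iff_contains eventually_cofinite Compl_eq)
  then show ?thesis by (simp add: frechet_def trivial_limit_def)
qed

text \<open>
  Arrows being unique, a cover is given by the set of its members; every clause below
  depends on an indexed family of arrows only through this set.
\<close>

definition covers :: "nat filter set \<Rightarrow> nat filter \<Rightarrow> bool" where
  "covers \<H> F \<longleftrightarrow>
     \<H> \<subseteq> frechet \<and>
     (\<forall>H\<in>\<H>. H \<le> F) \<and>
     (\<forall>H\<in>\<H>. \<forall>K\<in>frechet. K \<le> H \<longrightarrow> K \<in> \<H>) \<and>
     (\<forall>G\<in>frechet. G \<le> F \<longrightarrow> (\<exists>H\<in>\<H>. H \<le> G))"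

text \<open>
  A tuple of parameters is given as a valuation of all the variables; \<open>v x i\<close> is the i-th
  value of the sequence assigned to the variable x.
\<close>

primrec dag_forces :: "nat filter \<Rightarrow> (nat \<Rightarrow> nat \<Rightarrow> real) \<Rightarrow> fm \<Rightarrow> bool" where
  "dag_forces F v (Atom A) \<longleftrightarrow> eventually (\<lambda>i. atom_holds (\<lambda>x. v x i) A) F"
| "dag_forces F v (Neg p) \<longleftrightarrow> (\<forall>G\<in>frechet. G \<le> F \<longrightarrow> \<not> dag_forces G v p)"
| "dag_forces F v (Conj p q) \<longleftrightarrow> dag_forces F v p \<and> dag_forces F v q"
| "dag_forces F v (Disj p q) \<longleftrightarrow>
     (\<forall>G\<in>frechet. G \<le> F \<longrightarrow>
        (\<exists>H\<in>frechet. H \<le> G \<and> (dag_forces H v p \<or> dag_forces H v q)))"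
| "dag_forces F v (Impl p q) \<longleftrightarrow>
     (\<forall>G\<in>frechet. G \<le> F \<longrightarrow> dag_forces G v p \<longrightarrow> dag_forces G v q)"
| "dag_forces F v (All x p) \<longleftrightarrow> (\<forall>b. dag_forces F (v(x := b)) p)"
| "dag_forces F v (Ex x p) \<longleftrightarrow>
     (\<forall>G\<in>frechet. G \<le> F \<longrightarrow> (\<exists>H\<in>frechet. H \<le> G \<and> (\<exists>b. dag_forces H (v(x := b)) p)))"

definition red_rel :: "nat filter \<Rightarrow> ((nat \<Rightarrow> real) \<times> (nat \<Rightarrow> real)) set" where
  "red_rel F = {(a, a'). eventually (\<lambda>i. a i = a' i) F}"

definition red_class :: "nat filter \<Rightarrow> (nat \<Rightarrow> real) \<Rightarrow> (nat \<Rightarrow> real) set" where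
  "red_class F a = red_rel F `` {a}"

definition red_pow :: "nat filter \<Rightarrow> (nat \<Rightarrow> real) set set" where
  "red_pow F = UNIV // red_rel F"

text \<open>
  The transition map along an arrow from F to a larger G (that is, \<open>G \<le> F\<close>). It sends the
  F-class of a to the G-class of a, see \<open>red_map_class\<close>; its source F does not occur in the
  definition.
\<close>

definition red_map :: "nat filter \<Rightarrow> (nat \<Rightarrow> real) set \<Rightarrow> (nat \<Rightarrow> real) set" where
  "red_map G u = (\<Union>a\<in>u. red_class G a)"

lemma equiv_red_rel: "equiv UNIV (red_rel F)"
proof (rule equivI)
  show "refl (red_rel F)" by (simp add: refl_on_def red_rel_def)
  show "sym (red_rel F)" by (auto simp: sym_def red_rel_def eq_commute)
  show "trans (red_rel F)"
    by (auto simp: trans_def red_rel_def elim: eventually_elim2)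
qed auto

lemma red_class_eq_iff:
  "red_class F a = red_class F b \<longleftrightarrow> eventually (\<lambda>i. a i = b i) F"
  using equiv_class_eq_iff[OF equiv_red_rel[of F], of a b] by (simp add: red_class_def red_rel_def)

lemma red_map_class:
  assumes "G \<le> F"
  shows "red_map G (red_class F a) = red_class G a"
proof -
  have "red_class G b = red_class G a" if "b \<in> red_class F a" for b
    using that filter_leD[OF assms] unfolding red_class_eq_iff
    by (auto simp: red_class_def red_rel_def eq_commute)
  moreover have "a \<in> red_class F a" by (simp add: red_class_def red_rel_def)
  ultimately show ?thesis unfolding red_map_def by blast
qed

text \<open>
  In the atomic clause the parameters are written as classes of representatives; the choice
  of representatives is immaterial, see \<open>sheaf_forces_atom\<close>.
\<close>

primrec sheaf_forces ::
  "nat filter \<Rightarrow> (nat \<Rightarrow> (nat \<Rightarrow> real) set) \<Rightarrow> fm \<Rightarrow> bool" where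
  "sheaf_forces F u (Atom A) \<longleftrightarrow>
     (\<exists>a. u = red_class F \<circ> a \<and> eventually (\<lambda>i. atom_holds (\<lambda>x. a x i) A) F)"
| "sheaf_forces F u (Neg p) \<longleftrightarrow>
     (\<forall>G\<in>frechet. G \<le> F \<longrightarrow> \<not> sheaf_forces G (red_map G \<circ> u) p)"
| "sheaf_forces F u (Conj p q) \<longleftrightarrow> sheaf_forces F u p \<and> sheaf_forces F u q"
| "sheaf_forces F u (Disj p q) \<longleftrightarrow>
     (\<exists>\<H>. covers \<H> F \<and>
        (\<forall>H\<in>\<H>. sheaf_forces H (red_map H \<circ> u) p \<or> sheaf_forces H (red_map H \<circ> u) q))"
| "sheaf_forces F u (Impl p q) \<longleftrightarrow>
     (\<forall>G\<in>frechet. G \<le> F \<longrightarrow>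
        sheaf_forces G (red_map G \<circ> u) p \<longrightarrow> sheaf_forces G (red_map G \<circ> u) q)"
| "sheaf_forces F u (All x p) \<longleftrightarrow>
     (\<forall>G\<in>frechet. G \<le> F \<longrightarrow>
        (\<forall>b\<in>red_pow G. sheaf_forces G ((red_map G \<circ> u)(x := b)) p))"
| "sheaf_forces F u (Ex x p) \<longleftrightarrow>
     (\<exists>\<H>. covers \<H> F \<and>
        (\<forall>H\<in>\<H>. \<exists>b\<in>red_pow H. sheaf_forces H ((red_map H \<circ> u)(x := b)) p))"

primrec tm_vars :: "tm \<Rightarrow> nat list" where
  "tm_vars (Var x) = [x]"
| "tm_vars (Fn n f ts) = concat (map tm_vars ts)"

primrec atom_vars :: "atom \<Rightarrow> nat list" where
  "atom_vars (Eq s t) = tm_vars s @ tm_vars t"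
| "atom_vars (Rel n R ts) = concat (map tm_vars ts)"

lemma tm_val_cong: "(\<And>x. x \<in> set (tm_vars t) \<Longrightarrow> e x = e' x) \<Longrightarrow> tm_val e t = tm_val e' t"
proof (induction t)
  case (Fn n f ts)
  then have "map (tm_val e) ts = map (tm_val e') ts" by (intro map_cong) auto
  then show ?case by (simp only: tm_val.simps)
qed simp

lemma atom_holds_cong:
  assumes "\<And>x. x \<in> set (atom_vars A) \<Longrightarrow> e x = e' x"
  shows "atom_holds e A \<longleftrightarrow> atom_holds e' A"
proof (cases A)
  case (Eq s t)
  then show ?thesis using assms tm_val_cong[of s e e'] tm_val_cong[of t e e'] by simp
next
  case (Rel n R ts)
  then have "map (tm_val e) ts = map (tm_val e') ts"
    using assms by (intro map_cong tm_val_cong) auto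
  with Rel show ?thesis by (simp only: atom_holds.simps)
qed

lemma sheaf_forces_atom:
  "sheaf_forces F (red_class F \<circ> a) (Atom A) \<longleftrightarrow>
     eventually (\<lambda>i. atom_holds (\<lambda>x. a x i) A) F"
proof
  assume "sheaf_forces F (red_class F \<circ> a) (Atom A)"
  then obtain b where b: "red_class F \<circ> a = red_class F \<circ> b"
    and ev: "eventually (\<lambda>i. atom_holds (\<lambda>x. b x i) A) F"
    by auto
  have "eventually (\<lambda>i. a x i = b x i) F" for x
    using fun_cong[OF b, of x] by (simp add: red_class_eq_iff)
  then have "eventually (\<lambda>i. \<forall>x\<in>set (atom_vars A). a x i = b x i) F"
    by (simp add: eventually_ball_finite)
  with ev show "eventually (\<lambda>i. atom_holds (\<lambda>x. a x i) A) F"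
  proof eventually_elim
    case (elim i)
    then show ?case using atom_holds_cong[of A "\<lambda>x. a x i" "\<lambda>x. b x i"] by simp
  qed
qed auto

end

theory Submission imports Defs begin

text \<open>
  The maps are the quotient maps: \<open>\<pi> F a\<close> is the class of the sequence \<open>a\<close> in the reduced
  power modulo \<open>F\<close>. They commute with the transition maps by construction, and each of them is
  onto, so quantification over a reduced power is quantification over sequences. The two
  forcing relations are then compared by induction on the formula, and they can differ in two
  ways only.

  A universal quantifier ranges over all extensions \<open>G\<close> of \<open>F\<close> in the sheaf semantics, but
  only over \<open>F\<close> itself in the possibility structure. These agree because forcing in the
  possibility structure persists to larger filters (\<open>dag_forces_mono\<close>).

  Disjunction and existence refer to a cover of \<open>F\<close> in the sheaf semantics, but to density
  below \<open>F\<close> in the possibility structure. A cover is exactly a family of extensions of \<open>F\<close>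
  that is closed under further extension and dense below \<open>F\<close>. Hence, again by persistence, the
  extensions of \<open>F\<close> that force a disjunct, or that force an instance, themselves form a cover
  as soon as they are dense (\<open>cover_iff_dense\<close>).
\<close>

text \<open>
  An atomic formula persists because a larger filter has more sets. Negation, implication,
  disjunction and existence persist because their clauses speak about all extensions, of which
  a larger filter has fewer. Only conjunction and the universal quantifier, whose clauses stay
  at \<open>F\<close>, draw on the induction hypothesis.
\<close>

lemma dag_forces_mono:
  assumes "dag_forces F v \<phi>" "G \<le> F"
  shows "dag_forces G v \<phi>"
  using assms
proof (induction \<phi> arbitrary: v)
  case (Atom A)
  then show ?case by (auto dest: filter_leD)
next
  case (All x p)
  then show ?case by simp blast
qed (simp; meson order_trans)+

text \<open>
  Here \<open>P\<close> stands for what the possibility structure forces and \<open>Q\<close> for its sheaf counterpart.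
  The two are compared only on extensions of \<open>F\<close>, the filters to which parameters over \<open>F\<close>
  can be restricted. Given density, the cover is the largest candidate, the set of all
  extensions of \<open>F\<close> that satisfy \<open>P\<close>; persistence of \<open>P\<close> makes it closed under extension.
\<close>

lemma cover_iff_dense:
  assumes mono: "\<And>H K. P H \<Longrightarrow> K \<le> H \<Longrightarrow> P K"
    and eq: "\<And>H. H \<in> frechet \<Longrightarrow> H \<le> F \<Longrightarrow> Q H \<longleftrightarrow> P H"
  shows "(\<exists>\<H>. covers \<H> F \<and> (\<forall>H\<in>\<H>. Q H)) \<longleftrightarrow>
    (\<forall>G\<in>frechet. G \<le> F \<longrightarrow> (\<exists>H\<in>frechet. H \<le> G \<and> P H))"
proof
  assume "\<exists>\<H>. covers \<H> F \<and> (\<forall>H\<in>\<H>. Q H)"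
  then show "\<forall>G\<in>frechet. G \<le> F \<longrightarrow> (\<exists>H\<in>frechet. H \<le> G \<and> P H)"
    unfolding covers_def using eq by (meson subsetD)
next
  assume dense: "\<forall>G\<in>frechet. G \<le> F \<longrightarrow> (\<exists>H\<in>frechet. H \<le> G \<and> P H)"
  let ?C = "{H \<in> frechet. H \<le> F \<and> P H}"
  have "covers ?C F"
    unfolding covers_def
  proof (intro conjI ballI impI)
    fix H K assume "H \<in> ?C" "K \<in> frechet" "K \<le> H"
    then show "K \<in> ?C" using mono by (auto intro: order_trans)
  next
    fix G assume "G \<in> frechet" "G \<le> F"
    with dense show "\<exists>H\<in>?C. H \<le> G" by (auto intro: order_trans)
  qed auto
  then show "\<exists>\<H>. covers \<H> F \<and> (\<forall>H\<in>\<H>. Q H)" using eq by blast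
qed

lemma red_pow_eq_range: "red_pow F = range (red_class F)"
  by (auto simp: red_pow_def quotient_def red_class_def)

lemma sheaf_forces_class_iff_dag_forces:
  assumes "F \<in> frechet"
  shows "sheaf_forces F (red_class F \<circ> a) \<phi> \<longleftrightarrow> dag_forces F a \<phi>"
  using assms
proof (induction \<phi> arbitrary: F a)
  case (Atom A)
  show ?case unfolding sheaf_forces_atom by simp
next
  case (Neg p)
  then show ?case by (simp add: comp_def red_map_class)
next
  case (Conj p q)
  then show ?case by simp
next
  case (Disj p q)
  show ?case unfolding sheaf_forces.simps dag_forces.simps
    by (rule cover_iff_dense)
      (auto simp: comp_def red_map_class Disj.IH[unfolded comp_def] intro: dag_forces_mono)
next
  case (Impl p q)
  then show ?case by (simp add: comp_def red_map_class)
next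
  case (All x p)
  \<comment> \<open>Restricting the parameters to \<open>G\<close> and then assigning the class of \<open>b\<close> yields the classes
    of the updated valuation, to which the induction hypothesis applies.\<close>
  have instance_iff: "sheaf_forces G ((\<lambda>y. red_map G (red_class F (a y)))(x := red_class G b)) p \<longleftrightarrow>
      dag_forces G (a(x := b)) p" if "G \<in> frechet" "G \<le> F" for G b
    using that All.IH[of G "a(x := b)"] by (simp add: comp_def red_map_class fun_upd_def if_distrib)
  show ?case
    \<comment> \<open>From left to right take \<open>G = F\<close>; from right to left use persistence.\<close>
    using All.prems by (auto simp: comp_def red_pow_eq_range instance_iff intro: dag_forces_mono)
next
  case (Ex x p)
  have instance_iff: "sheaf_forces H ((\<lambda>y. red_map H (red_class F (a y)))(x := red_class H b)) p \<longleftrightarrow>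
      dag_forces H (a(x := b)) p" if "H \<in> frechet" "H \<le> F" for H b
    using that Ex.IH[of H "a(x := b)"] by (simp add: comp_def red_map_class fun_upd_def if_distrib)
  show ?case unfolding sheaf_forces.simps dag_forces.simps
    by (rule cover_iff_dense) (auto simp: comp_def red_pow_eq_range instance_iff intro: dag_forces_mono)
qed

theorem theorem5p9:
  "\<exists>\<pi> :: nat filter \<Rightarrow> (nat \<Rightarrow> real) \<Rightarrow> (nat \<Rightarrow> real) set.
     \<forall>F\<in>frechet. \<forall>G\<in>frechet.
       \<pi> F \<in> UNIV \<rightarrow> red_pow F \<and>
       (G \<le> F \<longrightarrow> red_map G \<circ> \<pi> F = \<pi> G) \<and>
       (\<forall>\<phi> (a :: nat \<Rightarrow> nat \<Rightarrow> real). wf_fm \<phi> \<longrightarrow>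
          (sheaf_forces F (\<pi> F \<circ> a) \<phi> \<longleftrightarrow> dag_forces F a \<phi>))"
  by (rule exI[of _ red_class])
    (auto simp: red_pow_eq_range fun_eq_iff red_map_class sheaf_forces_class_iff_dag_forces)

end
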